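(* The topological space $(\mathbb Z,\mathcal T)$ is totally disconnected.
   Context: $\mathbb N^*$ denotes the set of positive integers. For $a\in\mathbb Z$ and $b\in\mathbb N^*$, $a+b\mathbb Z:=\{a+bn:n\in\mathbb Z\}$. The topology $\mathcal T$ on $\mathbb Z$ (Fürstenberg's topology) is defined as follows: a set $A\subset\mathbb Z$ is open (belongs to $\mathcal T$) if, for each $a\in A$, there is $b\in\mathbb N^*$ such that $a+b\mathbb Z\subset A$. A topological space is totally disconnected if each of its maximal connected subsets consists of one single point. *)

theory Defs
  imports "HOL-Analysis.Analysis"
begin

definition arith_prog :: "int \<Rightarrow> int \<Rightarrow> int set" where
  "arith_prog a b = {a + b * n |n. True}"

(* The type int already carries the metric (discrete) topology through its type classes, so this
   topology is set up as a separate object of the abstract type "int topology". *)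

definition furstenberg_open :: "int set \<Rightarrow> bool" where
  "furstenberg_open A \<longleftrightarrow> (\<forall>a\<in>A. \<exists>b>0. arith_prog a b \<subseteq> A)"

definition furstenberg_topology :: "int topology" where
  "furstenberg_topology = topology furstenberg_open"

(* "topology L" is only meaningful when L is a topology. *)

lemma istopology_furstenberg_open: "istopology furstenberg_open"
  unfolding istopology_def
proof (intro conjI allI impI)
  fix S T assume S: "furstenberg_open S" and T: "furstenberg_open T"
  show "furstenberg_open (S \<inter> T)"
    unfolding furstenberg_open_def
  proof
    fix a assume "a \<in> S \<inter> T"
    with S T obtain b c where b: "b > 0" "arith_prog a b \<subseteq> S" and c: "c > 0" "arith_prog a c \<subseteq> T"
      unfolding furstenberg_open_def by blast
    have "arith_prog a (b * c) \<subseteq> arith_prog a b"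
    proof
      fix x assume "x \<in> arith_prog a (b * c)"
      then obtain n where "x = a + b * (c * n)"
        unfolding arith_prog_def by (auto simp only: mem_Collect_eq mult.assoc)
      then show "x \<in> arith_prog a b"
        unfolding arith_prog_def by blast
    qed
    moreover have "arith_prog a (b * c) \<subseteq> arith_prog a c"
    proof
      fix x assume "x \<in> arith_prog a (b * c)"
      then obtain n where "x = a + c * (b * n)"
        unfolding arith_prog_def by (auto simp only: mem_Collect_eq mult.assoc mult.left_commute)
      then show "x \<in> arith_prog a c"
        unfolding arith_prog_def by blast
    qed
    ultimately have "arith_prog a (b * c) \<subseteq> S \<inter> T"
      using b(2) c(2) by blast
    moreover have "b * c > 0"
      using b(1) c(1) by (rule mult_pos_pos)
    ultimately show "\<exists>d>0. arith_prog a d \<subseteq> S \<inter> T"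
      by blast
  qed
next
  fix \<K> assume "\<forall>K\<in>\<K>. furstenberg_open K"
  then show "furstenberg_open (\<Union>\<K>)"
    unfolding furstenberg_open_def by (metis UnionE Union_upper subset_trans)
qed

lemma openin_furstenberg_topology: "openin furstenberg_topology A \<longleftrightarrow> furstenberg_open A"
  by (simp add: furstenberg_topology_def istopology_furstenberg_open)

lemma topspace_furstenberg_topology: "topspace furstenberg_topology = UNIV"
proof -
  have "furstenberg_open UNIV"
    unfolding furstenberg_open_def using zero_less_one by blast
  then have "UNIV \<subseteq> topspace furstenberg_topology"
    by (intro openin_subset) (simp only: openin_furstenberg_topology)
  then show ?thesis
    by blast
qed

(* The empty set counts as connected for connectedin; it is maximal only in the empty space, which
   the condition "C \<noteq> {}" makes totally disconnected, as is usual. *)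

definition maximal_connected_in :: "'a topology \<Rightarrow> 'a set \<Rightarrow> bool" where
  "maximal_connected_in X C \<longleftrightarrow>
     C \<noteq> {} \<and> connectedin X C \<and> (\<forall>D. connectedin X D \<and> C \<subseteq> D \<longrightarrow> D = C)"

definition totally_disconnected_space :: "'a topology \<Rightarrow> bool" where
  "totally_disconnected_space X \<longleftrightarrow> (\<forall>C. maximal_connected_in X C \<longrightarrow> (\<exists>x. C = {x}))"

lemma maximal_connected_in_iff: "maximal_connected_in X C \<longleftrightarrow> C \<in> connected_components_of X"
proof
  assume C: "maximal_connected_in X C"
  then obtain x where x: "x \<in> C" and con: "connectedin X C"
    unfolding maximal_connected_in_def by blast
  have "C \<subseteq> connected_component_of_set X x"
    by (simp add: con connected_component_of_maximal x)
  then have "connected_component_of_set X x = C"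
    using C connectedin_connected_component_of[of X x] unfolding maximal_connected_in_def by simp
  moreover have "x \<in> topspace X"
    using con x connectedin_subset_topspace by blast
  ultimately show "C \<in> connected_components_of X"
    by (metis connected_component_in_connected_components_of)
next
  assume C: "C \<in> connected_components_of X"
  have ne: "C \<noteq> {}"
    using C by (rule nonempty_connected_components_of)
  have "D = C" if "connectedin X D" "C \<subseteq> D" for D
  proof -
    have "\<not> disjnt C D"
      using that(2) ne unfolding disjnt_def by blast
    then show ?thesis
      using connected_components_of_maximal[OF C that(1)] that(2) by blast
  qed
  then show "maximal_connected_in X C"
    using ne connectedin_connected_components_of[OF C] unfolding maximal_connected_in_def by simp
qed

end

theory Submission
  imports Defs
begin

text \<open>Every residue class modulo b > 0 is clopen: it is open, and its complement is a union of
  other classes modulo b (\<open>openin_furstenberg_arith_prog\<close>,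
  \<open>closedin_furstenberg_arith_prog\<close>). Distinct integers x and y lie in different
  classes modulo any b that does not divide y - x, so some clopen set separates them and no
  connected set contains both (\<open>connectedin_furstenberg_eq\<close>).\<close>

lemma mem_arith_prog_iff: "x \<in> arith_prog a b \<longleftrightarrow> b dvd x - a"
proof -
  have "x = a + b * n \<longleftrightarrow> x - a = b * n" for n
    by linarith
  then show ?thesis
    unfolding arith_prog_def dvd_def by simp
qed

lemma openin_furstenberg_arith_prog:
  assumes "b > 0"
  shows "openin furstenberg_topology (arith_prog a b)"
proof -
  have "arith_prog x b \<subseteq> arith_prog a b" if "x \<in> arith_prog a b" for x
  proof
    fix y assume "y \<in> arith_prog x b"
    then have "b dvd (y - x) + (x - a)"
      using that by (intro dvd_add) (simp_all only: mem_arith_prog_iff)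
    then show "y \<in> arith_prog a b"
      by (simp add: mem_arith_prog_iff)
  qed
  then show ?thesis
    using assms unfolding openin_furstenberg_topology furstenberg_open_def by blast
qed

text \<open>Classes modulo the same b are equal or disjoint, so the class of a point outside
  \<open>arith_prog a b\<close> stays outside it.\<close>

lemma closedin_furstenberg_arith_prog:
  assumes "b > 0"
  shows "closedin furstenberg_topology (arith_prog a b)"
proof -
  have "arith_prog x b \<subseteq> - arith_prog a b" if "x \<notin> arith_prog a b" for x
  proof
    fix y assume "y \<in> arith_prog x b"
    then have "b dvd y - x"
      by (simp add: mem_arith_prog_iff)
    \<comment> \<open>The difference simplifies to x - a, which b does not divide.\<close>
    then have "b dvd (y - a) - (y - x)" if "b dvd y - a"
      using that by (rule dvd_diff[rotated])
    with \<open>x \<notin> arith_prog a b\<close> show "y \<in> - arith_prog a b"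
      by (simp add: mem_arith_prog_iff) blast
  qed
  then show ?thesis
    using assms
    unfolding closedin_def topspace_furstenberg_topology openin_furstenberg_topology
      furstenberg_open_def Compl_eq_Diff_UNIV[symmetric]
    by blast
qed

lemma connectedin_furstenberg_eq:
  assumes C: "connectedin furstenberg_topology C" and "x \<in> C" "y \<in> C"
  shows "x = y"
proof -
  \<comment> \<open>A positive modulus larger than the distance from x to y: it divides y - x only
    if y - x = 0.\<close>
  define b where "b = \<bar>y - x\<bar> + 1"
  have "b > 0"
    unfolding b_def by linarith
  then have "C \<subseteq> arith_prog x b \<or> disjnt C (arith_prog x b)"
    using connectedin_clopen_cases[OF C closedin_furstenberg_arith_prog
        openin_furstenberg_arith_prog] by blast
  moreover have "x \<in> arith_prog x b"
    by (simp add: mem_arith_prog_iff)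
  ultimately have "b dvd y - x"
    using \<open>x \<in> C\<close> \<open>y \<in> C\<close> unfolding disjnt_iff mem_arith_prog_iff[symmetric] by blast
  then have "y - x = 0"
    using dvd_imp_le_int[of "y - x" b] unfolding b_def by linarith
  then show ?thesis
    by simp
qed

theorem theorem2:
  shows "totally_disconnected_space furstenberg_topology"
  \<comment> \<open>Maximal connected sets are nonempty by definition, so having at most one point
    makes them singletons.\<close>
  unfolding totally_disconnected_space_def maximal_connected_in_def
  using connectedin_furstenberg_eq by blast

end
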